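(* Let $p$ be a prime. If $\psi\in C(\mathbb{Z}_p,\mathbb{C}_p)$, $m\in\mathbb{Z}$, and $s\in\mathbb{Z}_p$, then $$\mathscr{I}(\mathscr{S}^m(\psi))(s) = \mathscr{I}(\psi)(s+m) .$$
   Context: $C(\mathbb{Z}_p,\mathbb{C}_p)$ is the $\mathbb{C}_p$-vector space of continuous functions $\mathbb{Z}_p \to \mathbb{C}_p$, and $\mathscr{S}$ is the $\mathbb{C}_p$-linear automorphism of $C(\mathbb{Z}_p,\mathbb{C}_p)$ given by $\mathscr{S}(\phi)(x) = \phi(x) - x\phi(x-1)$; $\mathscr{S}^m$ for $m\in\mathbb{Z}$ denotes its $m$th iterate (iterates of the inverse for $m<0$). For $\psi \in C(\mathbb{Z}_p,\mathbb{C}_p)$, $\mathscr{I}(\psi):\mathbb{Z}_p\to\mathbb{C}_p$ is the continuous function $\mathscr{I}(\psi)(s) = \sum_{n=0}^\infty n!\,\psi(-1-n)\binom{s}{n}$. *)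

theory Defs
  imports "HOL-Analysis.Analysis" "HOL-Computational_Algebra.Computational_Algebra"
begin

definition is_subfield :: "'a::field set \<Rightarrow> bool" where
  "is_subfield F \<longleftrightarrow> 0 \<in> F \<and> 1 \<in> F \<and> (\<forall>x\<in>F. \<forall>y\<in>F. x - y \<in> F \<and> x * y \<in> F)
     \<and> (\<forall>x\<in>F. inverse x \<in> F)"

definition algebraic_over :: "'a::field set \<Rightarrow> 'a \<Rightarrow> bool" where
  "algebraic_over F x \<longleftrightarrow> (\<exists>q. q \<noteq> 0 \<and> (\<forall>i. coeff q i \<in> F) \<and> poly q x = 0)"

definition is_algebraic_closure :: "'a::field set \<Rightarrow> 'a set \<Rightarrow> bool" where
  "is_algebraic_closure F L \<longleftrightarrow> is_subfield F \<and> is_subfield L \<and> F \<subseteq> L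
     \<and> (\<forall>x\<in>L. algebraic_over F x)
     \<and> (\<forall>q. (\<forall>i. coeff q i \<in> L) \<and> degree q > 0 \<longrightarrow> (\<exists>x\<in>L. poly q x = 0))"

text \<open>
  The field \<open>\<complex>\<^sub>p\<close> is unique only up to isometric isomorphism: it is a completion of an
  algebraic closure of \<open>\<rat>\<^sub>p\<close>, with the absolute value extending the \<open>p\<close>-adic one.
  The locale below says that the type \<open>'a\<close>, with the absolute value \<open>av\<close>, is such a field.
  Completeness is the class \<open>complete_space\<close>, whose metric (hence also topology, continuity
  and infinite sums) is tied to \<open>av\<close> by \<open>dist_av\<close>.

  Since \<open>'a\<close> is complete and \<open>av\<close> restricts to the \<open>p\<close>-adic absolute value on \<open>\<int>\<close> and \<open>\<rat>\<close>,
  the completions \<open>\<int>\<^sub>p\<close> and \<open>\<rat>\<^sub>p\<close> are the topological closures of \<open>\<int>\<close> and \<open>\<rat>\<close> in \<open>'a\<close>.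
\<close>

definition Zp :: "'a::{field_char_0,complete_space} set" where
  "Zp = closure \<int>"

definition Qp :: "'a::{field_char_0,complete_space} set" where
  "Qp = closure \<rat>"

locale padic_complex_field =
  fixes p :: nat and av :: "'a::{field_char_0,complete_space} \<Rightarrow> real"
  assumes prime_p: "prime p"
    and dist_av: "dist x y = av (x - y)"
    and av_mult: "av (x * y) = av x * av y"
    and av_ultrametric: "av (x + y) \<le> max (av x) (av y)"
    and av_of_int: "k \<noteq> 0 \<Longrightarrow> av (of_int k) = (1 / real p) ^ multiplicity (int p) k"
    and dense_algebraic_closure: "\<exists>L. is_algebraic_closure Qp L \<and> closure L = (UNIV :: 'a set)"

text \<open>
  Functions \<open>\<int>\<^sub>p \<Rightarrow> \<complex>\<^sub>p\<close> are represented by functions that are \<open>undefined\<close> outside \<open>\<int>\<^sub>p\<close>,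
  so that equality in \<open>C_Zp\<close> is equality of functions on \<open>\<int>\<^sub>p\<close>.
\<close>

definition C_Zp :: "('a::{field_char_0,complete_space} \<Rightarrow> 'a) set" where
  "C_Zp = {\<phi> \<in> extensional Zp. continuous_on Zp \<phi>}"

definition S_op :: "('a::{field_char_0,complete_space} \<Rightarrow> 'a) \<Rightarrow> 'a \<Rightarrow> 'a" where
  "S_op \<phi> = (\<lambda>x\<in>Zp. \<phi> x - x * \<phi> (x - 1))"

text \<open>
  The inverse used for negative exponents is that of the map \<open>S_op\<close> from \<open>C_Zp\<close> to itself.
\<close>

definition S_pow :: "int \<Rightarrow> ('a::{field_char_0,complete_space} \<Rightarrow> 'a) \<Rightarrow> 'a \<Rightarrow> 'a" where
  "S_pow m = (if m \<ge> 0 then S_op ^^ nat m else inv_into C_Zp S_op ^^ nat (- m))"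

definition I_op :: "('a::{field_char_0,complete_space} \<Rightarrow> 'a) \<Rightarrow> 'a \<Rightarrow> 'a" where
  "I_op \<psi> s = (\<Sum>n. fact n * \<psi> (- 1 - of_nat n) * (s gchoose n))"

end

theory Submission
  imports Defs
begin

text \<open>
  Write \<open>S = 1 - M\<close> with \<open>(M \<phi>)(x) = x \<phi>(x - 1)\<close>. Iterating gives
  \<open>(M\<^sup>n \<phi>)(x) = x (x - 1) \<dots> (x - n + 1) \<phi>(x - n) = n! (x choose n) \<phi>(x - n)\<close>.
  On the \<open>p\<close>-adic integers binomial coefficients have absolute value at most 1
  (\<open>av_gbinomial_le_1\<close>), a continuous \<open>\<phi>\<close> is bounded because the \<open>p\<close>-adic integers are compact
  (\<open>compact_Zp\<close>), and \<open>n!\<close> tends to 0 (\<open>av_fact_tendsto_0\<close>). So \<open>M\<^sup>n \<phi>\<close> tends to 0 uniformly.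
  Hence \<open>S\<close> is injective, since \<open>M d = d\<close> forces \<open>d = M\<^sup>n d\<close> for all \<open>n\<close> and so \<open>d = 0\<close>; and it is
  surjective, since the Neumann series \<open>\<Sum>n. M\<^sup>n \<psi>\<close> converges uniformly to a continuous preimage
  of \<open>\<psi>\<close>. This makes the negative iterates genuine inverses.

  For a single application of \<open>S\<close>, expand \<open>(S \<psi>)(-1-n) = \<psi>(-1-n) + (n+1) \<psi>(-1-(n+1))\<close> in the
  series and \<open>(s+1 choose n) = (s choose n) + (s choose n-1)\<close> in the shifted one: the two series
  then have the same summands up to an index shift, and their partial sums differ by a single
  term, which tends to 0 (\<open>I_op_S_op\<close>). Induction gives all \<open>m \<ge> 0\<close>. For \<open>m = - n < 0\<close> the
  case of the positive exponent \<open>n\<close> is applied to the function \<open>S\<^sup>m \<psi>\<close> at the point \<open>s + m\<close>.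
\<close>

section \<open>Continuity of the ring operations\<close>

context padic_complex_field
begin

lemma av_0 [simp]: "av 0 = 0"
  using dist_av[of 0 0] by simp

lemma av_nonneg [simp]: "0 \<le> av x"
  using dist_av[of x 0] by (metis diff_zero zero_le_dist)

lemma av_1 [simp]: "av 1 = 1"
  using av_of_int[of 1] by simp

lemma av_minus_commute: "av (x - y) = av (y - x)"
  by (metis dist_av dist_commute)

lemma av_diff_ultrametric: "av (x - y) \<le> max (av x) (av y)"
  using av_ultrametric[of x "0 - y"] av_minus_commute[of 0 y] by simp

lemma av_power: "av (x ^ n) = av x ^ n"
  by (induction n) (auto simp: av_mult)

lemma av_sum_le_bound:
  assumes "\<And>i. i \<in> I \<Longrightarrow> av (f i) \<le> B" and "0 \<le> B"
  shows "av (sum f I) \<le> B"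
  using assms
proof (induction I rule: infinite_finite_induct)
  case (insert i I)
  then show ?case
    using av_ultrametric[of "f i" "sum f I"] by (simp add: le_max_iff_disj) (smt (verit))
qed auto

text \<open>
  The type is not an instance of a topological ring class; that addition and multiplication are
  continuous has to be read off from the absolute value.
\<close>

lemma tendsto_iff_av: "(f \<longlongrightarrow> l) F \<longleftrightarrow> ((\<lambda>x. av (f x - l)) \<longlongrightarrow> 0) F"
  by (simp add: tendsto_dist_iff[of f] dist_av)

lemma tendsto_av_comparison:
  assumes "(h \<longlongrightarrow> 0) F" "\<And>x. av (f x - l) \<le> h x"
  shows "(f \<longlongrightarrow> l) F"
  unfolding tendsto_iff_av
  by (rule tendsto_sandwich[OF _ _ tendsto_const assms(1)]) (simp_all add: assms(2))

lemma tendsto_av_diff: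
  fixes f g :: "'b \<Rightarrow> 'a"
  assumes "(f \<longlongrightarrow> a) F" "(g \<longlongrightarrow> b) F"
  shows "((\<lambda>x. f x - g x) \<longlongrightarrow> a - b) F"
proof -
  have "((\<lambda>x. max (av (f x - a)) (av (g x - b))) \<longlongrightarrow> max 0 0) F"
    using assms by (intro tendsto_max) (auto simp: tendsto_iff_av)
  moreover have "av (f x - g x - (a - b)) \<le> max (av (f x - a)) (av (g x - b))" for x
    using av_diff_ultrametric[of "f x - a" "g x - b"] by (simp add: algebra_simps)
  ultimately show ?thesis
    by (intro tendsto_av_comparison) simp_all
qed

lemma tendsto_av_add:
  fixes f g :: "'b \<Rightarrow> 'a"
  assumes "(f \<longlongrightarrow> a) F" "(g \<longlongrightarrow> b) F"
  shows "((\<lambda>x. f x + g x) \<longlongrightarrow> a + b) F"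
  using tendsto_av_diff[OF assms(1) tendsto_av_diff[OF tendsto_const[of 0] assms(2)]] by simp

lemma tendsto_av_mult:
  fixes f g :: "'b \<Rightarrow> 'a"
  assumes "(f \<longlongrightarrow> a) F" "(g \<longlongrightarrow> b) F"
  shows "((\<lambda>x. f x * g x) \<longlongrightarrow> a * b) F"
proof -
  let ?u = "\<lambda>x. av (f x - a)" and ?v = "\<lambda>x. av (g x - b)"
  have "((\<lambda>x. ?u x * ?v x + (?u x * av b + av a * ?v x)) \<longlongrightarrow> 0 * 0 + (0 * av b + av a * 0)) F"
    using assms by (intro tendsto_intros) (auto simp: tendsto_iff_av)
  moreover have "av (f x * g x - a * b) \<le> ?u x * ?v x + (?u x * av b + av a * ?v x)" for x
  proof -
    \<comment> \<open>Expand the error around the limits; each summand contains a factor that tends to 0.\<close>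
    have "f x * g x - a * b = (f x - a) * (g x - b) + ((f x - a) * b + a * (g x - b))"
      by (simp add: algebra_simps)
    also have "av \<dots> \<le> av ((f x - a) * (g x - b)) + (av ((f x - a) * b) + av (a * (g x - b)))"
      using av_ultrametric av_nonneg by (smt (verit))
    finally show ?thesis
      by (simp add: av_mult)
  qed
  ultimately show ?thesis
    by (intro tendsto_av_comparison) simp_all
qed

lemma continuous_on_av_diff:
  "continuous_on A f \<Longrightarrow> continuous_on A g \<Longrightarrow> continuous_on A (\<lambda>x. f x - g x)"
  for f g :: "'b::topological_space \<Rightarrow> 'a"
  by (simp add: continuous_on_def tendsto_av_diff)

lemma continuous_on_av_add:
  "continuous_on A f \<Longrightarrow> continuous_on A g \<Longrightarrow> continuous_on A (\<lambda>x. f x + g x)"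
  for f g :: "'b::topological_space \<Rightarrow> 'a"
  by (simp add: continuous_on_def tendsto_av_add)

lemma continuous_on_av_mult:
  "continuous_on A f \<Longrightarrow> continuous_on A g \<Longrightarrow> continuous_on A (\<lambda>x. f x * g x)"
  for f g :: "'b::topological_space \<Rightarrow> 'a"
  by (simp add: continuous_on_def tendsto_av_mult)

lemma continuous_on_av:
  "continuous_on A f \<Longrightarrow> continuous_on A (\<lambda>x. av (f x))"
  using continuous_on_dist[of A f "\<lambda>_. 0"] by (simp add: dist_av)

section \<open>The ring of p-adic integers\<close>

lemma of_int_in_Zp [simp]: "of_int k \<in> (Zp :: 'a set)"
  unfolding Zp_def by (rule subsetD[OF closure_subset]) simp

lemma Zp_approx:
  assumes "x \<in> Zp" "e > 0"
  obtains k where "av (x - of_int k) < e"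
proof -
  obtain y where "y \<in> \<int>" "dist y x < e"
    using assms unfolding Zp_def closure_approachable by blast
  then show thesis
    using that by (auto simp: Ints_def dist_av av_minus_commute)
qed

lemma Zp_diff [simp]:
  fixes x y :: 'a
  assumes "x \<in> Zp" "y \<in> Zp"
  shows "x - y \<in> Zp"
proof -
  have "\<exists>z\<in>\<int>. dist z (x - y) < e" if "e > 0" for e
  proof -
    obtain k l where "av (x - of_int k) < e" "av (y - of_int l) < e"
      using assms \<open>e > 0\<close> by (meson Zp_approx)
    then have "av ((x - of_int k) - (y - of_int l)) < e"
      by (intro le_less_trans[OF av_diff_ultrametric]) simp
    also have "(x - of_int k) - (y - of_int l) = x - y - of_int (k - l)"
      by simp
    finally have "av (x - y - of_int (k - l)) < e" .
    then show ?thesis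
      by (intro bexI[of _ "of_int (k - l)"]) (auto simp: dist_av av_minus_commute)
  qed
  then show ?thesis
    by (simp add: Zp_def closure_approachable)
qed

lemma Zp_ints [simp]: "1 \<in> (Zp :: 'a set)" "of_nat n \<in> (Zp :: 'a set)"
  "- 1 - of_nat n \<in> (Zp :: 'a set)"
  using of_int_in_Zp[of 1] of_int_in_Zp[of "int n"]
    of_int_in_Zp[of "- 1 - int n"] by simp_all

lemma Zp_add_of_int:
  fixes x :: 'a
  assumes "x \<in> Zp"
  shows "x + of_int k \<in> Zp"
  using Zp_diff[OF assms of_int_in_Zp[of "- k"]] by simp

lemma av_of_int_le_1: "av (of_int k) \<le> 1"
proof (cases "k = 0")
  case False
  then show ?thesis
    using prime_gt_1_nat[OF prime_p] by (simp add: av_of_int power_le_one)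
qed simp

lemma av_prime: "av (of_nat p) = 1 / real p"
  using av_of_int[of "int p"] prime_p prime_gt_1_nat[OF prime_p]
  by (simp add: multiplicity_prime)

text \<open>
  Every element of \<open>Zp\<close> is within \<open>p\<^sup>-\<^sup>N\<close> of one of the integers \<open>0, \<dots>, p\<^sup>N - 1\<close>, so \<open>Zp\<close> is
  totally bounded; it is complete because it is closed.
\<close>

lemma compact_Zp: "compact (Zp :: 'a set)"
  unfolding compact_eq_totally_bounded
proof (intro conjI allI impI)
  show "complete (Zp :: 'a set)"
    by (simp add: Zp_def complete_eq_closed)
  fix e :: real assume "e > 0"
  have "1 / real p < 1"
    using prime_gt_1_nat[OF prime_p] by simp
  then obtain N where N: "(1 / real p) ^ N < e"
    using real_arch_pow_inv \<open>e > 0\<close> by blast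
  define K where "K = (of_int :: int \<Rightarrow> 'a) ` {0..<int (p ^ N)}"
  have "x \<in> (\<Union>y\<in>K. ball y e)" if x: "x \<in> Zp" for x
  proof -
    obtain k where k: "av (x - of_int k) < e"
      by (rule Zp_approx[OF x \<open>e > 0\<close>])
    define r where "r = k mod int (p ^ N)"
    have "of_int k - of_int r = (of_nat p ^ N * of_int (k div int (p ^ N)) :: 'a)"
      by (metis r_def minus_mod_eq_mult_div of_int_diff of_int_mult of_int_of_nat_eq of_nat_power)
    then have "av (of_int k - of_int r) \<le> (1 / real p) ^ N"
      using av_of_int_le_1 by (simp add: av_mult av_power av_prime mult_left_le divide_right_mono
          power_one_over)
    then have "av (x - of_int r) < e"
      using k N av_ultrametric[of "x - of_int k" "of_int k - of_int r"] by simp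
    moreover have "of_int r \<in> K"
      using prime_gt_0_nat[OF prime_p] by (auto simp: K_def r_def)
    ultimately show ?thesis
      by (auto simp: dist_av av_minus_commute)
  qed
  then show "\<exists>K. finite K \<and> (Zp :: 'a set) \<subseteq> (\<Union>y\<in>K. ball y e)"
    by (intro exI[of _ K]) (auto simp: K_def)
qed

lemma C_Zp_bounded:
  fixes \<phi> :: "'a \<Rightarrow> 'a"
  assumes "\<phi> \<in> C_Zp"
  obtains B where "B > 0" "\<And>x. x \<in> Zp \<Longrightarrow> av (\<phi> x) \<le> B"
proof -
  have "compact ((\<lambda>x. av (\<phi> x)) ` Zp)"
    using assms by (intro compact_continuous_image continuous_on_av compact_Zp) (simp add: C_Zp_def)
  then obtain B where B: "\<forall>y\<in>(\<lambda>x. av (\<phi> x)) ` Zp. norm y \<le> B"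
    using compact_imp_bounded bounded_iff by blast
  then have "av (\<phi> x) \<le> max B 1" if "x \<in> Zp" for x
    using that by fastforce
  then show thesis
    by (intro that[of "max B 1"]) auto
qed

section \<open>Falling factorials of p-adic integers\<close>

text \<open>
  Falling factorials are written as \<open>fact n * (x gchoose n)\<close>, the form in which they occur in the
  series. The recursion peels off the first factor \<open>x\<close>, matching one application of
  \<open>\<phi> \<mapsto> (\<lambda>x. x * \<phi> (x - 1))\<close>.
\<close>

lemma falling_factorial_Suc:
  "fact (Suc n) * (x gchoose Suc n) = x * (fact n * ((x - 1) gchoose n))" for x :: 'a
proof -
  have "fact (Suc n) * (x gchoose Suc n) = fact n * (of_nat (Suc n) * (x gchoose Suc n))"
    by (simp add: algebra_simps)
  then show ?thesis
    by (simp only: gbinomial_absorption mult.left_commute)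
qed

lemma continuous_on_gbinomial: "continuous_on A (\<lambda>x :: 'a. x gchoose n)"
proof (induction n arbitrary: A)
  case (Suc n)
  have "continuous_on A (\<lambda>x :: 'a. (x - 1) gchoose n)"
    by (intro continuous_on_compose2[OF Suc[of UNIV]] continuous_on_av_diff) auto
  then have "continuous_on A (\<lambda>x :: 'a. inverse (of_nat (Suc n)) * (x * ((x - 1) gchoose n)))"
    by (intro continuous_on_av_mult) auto
  then show ?case
    by (simp only: gbinomial_absorption[symmetric]) (simp flip: mult.assoc del: of_nat_Suc)
qed simp

text \<open>
  Binomial coefficients of integers are integers, and the bound extends to the closure by
  continuity.
\<close>

lemma av_gbinomial_le_1:
  assumes "x \<in> Zp"
  shows "av (x gchoose n) \<le> 1"
proof (rule continuous_le_on_closure[of "\<int>" "\<lambda>x. av (x gchoose n)"])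
  show "continuous_on (closure \<int>) (\<lambda>x. av (x gchoose n))"
    by (intro continuous_on_av continuous_on_gbinomial)
  show "x \<in> closure \<int>"
    using assms by (simp add: Zp_def)
  show "av (y gchoose n) \<le> 1" if "y \<in> \<int>" for y
    using that by (auto simp: Ints_def of_int_gbinomial[symmetric] av_of_int_le_1)
qed

text \<open>
  Each of the \<open>n div p\<close> multiples of \<open>p\<close> among \<open>1, \<dots>, n\<close> contributes a factor of absolute value at
  most \<open>1/p\<close>. This weak form of Legendre's formula already forces \<open>n!\<close> to tend to 0.
\<close>

lemma av_fact_le: "av (fact n) \<le> (1 / real p) ^ (n div p)"
proof (induction n)
  case (Suc n)
  have *: "av (fact (Suc n)) = av (of_nat (Suc n)) * av (fact n)"
    by (simp only: fact_Suc av_mult)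
  show ?case
  proof (cases "p dvd Suc n")
    case True
    then obtain j where "Suc n = p * j" ..
    then have "av (of_nat (Suc n)) = 1 / real p * av (of_int (int j))"
      by (simp only: of_nat_mult av_mult av_prime of_int_of_nat_eq)
    also have "\<dots> \<le> 1 / real p * 1"
      by (intro mult_left_mono av_of_int_le_1) auto
    finally have "av (of_nat (Suc n)) \<le> 1 / real p" by simp
    then have "av (fact (Suc n)) \<le> 1 / real p * (1 / real p) ^ (n div p)"
      unfolding * using Suc by (intro mult_mono) auto
    then show ?thesis
      using True by (simp add: div_Suc mod_eq_0_iff_dvd)
  next
    case False
    have "av (fact (Suc n)) \<le> 1 * (1 / real p) ^ (n div p)"
      unfolding * using Suc av_of_int_le_1[of "int (Suc n)"] by (intro mult_mono) auto
    then show ?thesis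
      using False by (simp add: div_Suc mod_eq_0_iff_dvd)
  qed
qed simp

lemma decseq_av_fact: "decseq (\<lambda>n. av (fact n))"
proof (rule decseq_SucI)
  fix n
  have "av (fact (Suc n)) = av (of_int (int (Suc n))) * av (fact n)"
    by (simp only: fact_Suc av_mult of_int_of_nat_eq)
  also have "\<dots> \<le> av (fact n)"
    by (intro mult_left_le_one_le av_of_int_le_1) auto
  finally show "av (fact (Suc n)) \<le> av (fact n)" .
qed

lemma av_fact_tendsto_0: "(\<lambda>n. av (fact n)) \<longlonglongrightarrow> 0"
proof (rule tendsto_sandwich[OF _ _ tendsto_const])
  have p: "p > 1"
    using prime_p by (rule prime_gt_1_nat)
  have "filterlim (\<lambda>n. n div p) at_top sequentially"
    unfolding filterlim_at_top eventually_sequentially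
  proof (intro allI exI impI)
    show "Z \<le> n div p" if "Z * p \<le> n" for Z n
      using div_le_mono[OF that, of p] p by simp
  qed
  then show "(\<lambda>n. (1 / real p) ^ (n div p)) \<longlonglongrightarrow> 0"
    using p by (intro filterlim_compose[OF LIMSEQ_power_zero]) auto
qed (auto simp: av_fact_le)

lemma av_falling_factorial_le:
  assumes "x \<in> Zp"
  shows "av (fact n * (x gchoose n) * y) \<le> av (fact n) * av y"
  using mult_right_mono[OF mult_left_le[OF av_gbinomial_le_1[OF assms, of n] av_nonneg[of "fact n"]]]
  by (simp add: av_mult)

section \<open>The operator is a bijection\<close>

lemma S_op_C_Zp:
  fixes \<phi> :: "'a \<Rightarrow> 'a"
  assumes "\<phi> \<in> C_Zp"
  shows "S_op \<phi> \<in> C_Zp"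
proof -
  have \<phi>: "continuous_on Zp \<phi>"
    using assms by (simp add: C_Zp_def)
  have "continuous_on Zp (\<lambda>x. \<phi> (x - 1))"
    by (intro continuous_on_compose2[OF \<phi>] continuous_on_av_diff) auto
  then have "continuous_on Zp (\<lambda>x. \<phi> x - x * \<phi> (x - 1))"
    using \<phi> by (intro continuous_on_av_diff continuous_on_av_mult) auto
  then show ?thesis
    by (simp add: C_Zp_def S_op_def)
qed

text \<open>
  The difference \<open>d\<close> of two functions with the same image satisfies \<open>d(x) = x d(x - 1)\<close>, hence
  \<open>d(x) = n! (x choose n) d(x - n)\<close> for every \<open>n\<close>, which tends to 0.
\<close>

lemma inj_on_S_op: "inj_on S_op (C_Zp :: ('a \<Rightarrow> 'a) set)"
proof (rule inj_onI)
  fix \<phi> \<theta> :: "'a \<Rightarrow> 'a"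
  assume \<phi>: "\<phi> \<in> C_Zp" and \<theta>: "\<theta> \<in> C_Zp" and eq: "S_op \<phi> = S_op \<theta>"
  define d where "d x = \<phi> x - \<theta> x" for x
  have step: "d x = x * d (x - 1)" if "x \<in> Zp" for x
    using fun_cong[OF eq, of x] that by (simp add: S_op_def d_def algebra_simps)
  have iter: "d x = fact n * (x gchoose n) * d (x - of_nat n)" if "x \<in> Zp" for x n
    using that
  proof (induction n arbitrary: x)
    case (Suc n)
    have "d x = x * (fact n * ((x - 1) gchoose n) * d (x - 1 - of_nat n))"
      using step[OF Suc.prems] Suc.IH[of "x - 1"] Suc.prems by simp
    then show ?case
      by (simp only: falling_factorial_Suc) (simp add: algebra_simps)
  qed simp
  obtain B C where B: "\<And>x. x \<in> Zp \<Longrightarrow> av (\<phi> x) \<le> B" and C: "\<And>x. x \<in> Zp \<Longrightarrow> av (\<theta> x) \<le> C"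
    using C_Zp_bounded[OF \<phi>] C_Zp_bounded[OF \<theta>] by metis
  have "\<phi> x = \<theta> x" if x: "x \<in> Zp" for x
  proof -
    have "av (d x) \<le> av (fact n) * max B C" for n
    proof -
      have "av (d (x - of_nat n)) \<le> max B C"
        unfolding d_def using B C x by (intro order.trans[OF av_diff_ultrametric] max.mono) auto
      then show ?thesis
        using av_falling_factorial_le[OF x, of n "d (x - of_nat n)"] iter[OF x, of n]
        by (metis av_nonneg mult_left_mono order.trans)
    qed
    moreover have "(\<lambda>n. av (fact n) * max B C) \<longlonglongrightarrow> 0 * max B C"
      by (intro tendsto_intros av_fact_tendsto_0)
    ultimately have "av (d x) \<le> 0"
      by (intro LIMSEQ_le_const[of "\<lambda>n. av (fact n) * max B C"]) auto
    then show ?thesis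
      using dist_av[of "\<phi> x" "\<theta> x"] by (simp add: d_def) (metis dist_le_zero_iff)
  qed
  then show "\<phi> = \<theta>"
    using \<phi> \<theta> by (intro extensionalityI[of _ Zp]) (auto simp: C_Zp_def)
qed

text \<open>
  A preimage is the Neumann series \<open>\<Sum>k. k! (x choose k) \<psi>(x - k)\<close>. By the ultrametric inequality
  its tails are bounded by their largest term, so it converges uniformly and the sum is continuous.
\<close>

lemma S_op_surj:
  fixes \<psi> :: "'a \<Rightarrow> 'a"
  assumes "\<psi> \<in> C_Zp"
  obtains \<phi> where "\<phi> \<in> C_Zp" "S_op \<phi> = \<psi>"
proof -
  have \<psi>: "continuous_on Zp \<psi>" "\<psi> \<in> extensional Zp"
    using assms by (auto simp: C_Zp_def)
  obtain B where "B > 0" and B: "\<And>x. x \<in> Zp \<Longrightarrow> av (\<psi> x) \<le> B"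
    using C_Zp_bounded[OF assms] by blast
  define f where "f n x = (\<Sum>k<n. fact k * (x gchoose k) * \<psi> (x - of_nat k))" for n x
  have cont: "continuous_on Zp (f n)" for n
    unfolding f_def
  proof (induction n)
    case (Suc n)
    have "continuous_on Zp (\<lambda>x. \<psi> (x - of_nat n))"
      by (intro continuous_on_compose2[OF \<psi>(1)] continuous_on_av_diff) auto
    then show ?case
      using Suc by (auto intro!: continuous_on_av_add continuous_on_av_mult continuous_on_gbinomial)
  qed simp
  \<comment> \<open>In the limit this recursion becomes the equation for a preimage.\<close>
  have f_Suc: "f (Suc n) x = \<psi> x + x * f n (x - 1)" for n x
    unfolding f_def sum.lessThan_Suc_shift falling_factorial_Suc
    by (simp add: sum_distrib_left algebra_simps)
  have diff: "dist (f m x) (f n x) \<le> av (fact m) * B" if "m \<le> n" "x \<in> Zp" for m n x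
  proof -
    have "f n x - f m x = (\<Sum>k=m..<n. fact k * (x gchoose k) * \<psi> (x - of_nat k))"
      using sum_diff_nat_ivl[of 0 m n] \<open>m \<le> n\<close> by (simp add: f_def atLeast0LessThan)
    moreover have "av (fact k * (x gchoose k) * \<psi> (x - of_nat k)) \<le> av (fact m) * B"
      if "k \<ge> m" for k
    proof -
      have "av (fact k) * av (\<psi> (x - of_nat k)) \<le> av (fact m) * B"
        using B \<open>x \<in> Zp\<close> decseqD[OF decseq_av_fact that] by (intro mult_mono) auto
      then show ?thesis
        by (rule order.trans[OF av_falling_factorial_le[OF \<open>x \<in> Zp\<close>]])
    qed
    ultimately have "av (f n x - f m x) \<le> av (fact m) * B"
      using \<open>B > 0\<close> by (auto intro!: av_sum_le_bound)
    then show ?thesis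
      by (simp add: dist_av av_minus_commute)
  qed
  have "uniformly_Cauchy_on Zp f"
  proof (rule uniformly_Cauchy_onI')
    fix e :: real assume "e > 0"
    have "(\<lambda>m. av (fact m) * B) \<longlonglongrightarrow> 0 * B"
      by (intro tendsto_intros av_fact_tendsto_0)
    then have "\<forall>\<^sub>F m in sequentially. av (fact m) * B < e"
      using \<open>e > 0\<close> by (intro order_tendstoD(2)) auto
    then obtain M where "\<And>m. m \<ge> M \<Longrightarrow> av (fact m) * B < e"
      by (auto simp: eventually_sequentially)
    then show "\<exists>M. \<forall>x\<in>Zp. \<forall>m\<ge>M. \<forall>n>m. dist (f m x) (f n x) < e"
      by (meson diff le_less_trans less_imp_le)
  qed
  then obtain g where g: "uniform_limit Zp f g sequentially"
    using Cauchy_uniformly_convergent uniformly_convergent_on_def by blast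
  have cont_g: "continuous_on Zp g"
    using g cont by (intro uniform_limit_theorem[of _ f]) auto
  have lim: "(\<lambda>n. f n x) \<longlonglongrightarrow> g x" if "x \<in> Zp" for x
    using g that by (rule tendsto_uniform_limitI)
  have rec: "g x = \<psi> x + x * g (x - 1)" if "x \<in> Zp" for x
  proof (rule LIMSEQ_unique)
    show "(\<lambda>n. f (Suc n) x) \<longlonglongrightarrow> g x"
      using lim[OF that] by (rule LIMSEQ_Suc)
    show "(\<lambda>n. f (Suc n) x) \<longlonglongrightarrow> \<psi> x + x * g (x - 1)"
      unfolding f_Suc using that by (intro tendsto_av_add tendsto_av_mult lim) auto
  qed
  have "restrict g Zp \<in> C_Zp"
    using cont_g by (simp add: C_Zp_def)
  moreover have "S_op (restrict g Zp) = \<psi>"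
    using rec \<psi>(2) by (intro extensionalityI[of _ Zp]) (auto simp: S_op_def algebra_simps)
  ultimately show thesis
    using that by blast
qed

lemma bij_betw_S_op: "bij_betw S_op C_Zp (C_Zp :: ('a \<Rightarrow> 'a) set)"
proof (rule bij_betwI')
  show "S_op \<phi> = S_op \<theta> \<longleftrightarrow> \<phi> = \<theta>" if "\<phi> \<in> C_Zp" "\<theta> \<in> C_Zp" for \<phi> \<theta> :: "'a \<Rightarrow> 'a"
    using that by (simp add: inj_on_eq_iff[OF inj_on_S_op])
  show "\<exists>\<phi>\<in>C_Zp. \<psi> = S_op \<phi>" if "\<psi> \<in> C_Zp" for \<psi> :: "'a \<Rightarrow> 'a"
    using S_op_surj[OF that] by blast
qed (rule S_op_C_Zp)

section \<open>The interpolation series\<close>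

text \<open>
  The difference of the partial sums of the two series telescopes to a single term that tends to
  0, so the two sequences of partial sums have the same limits.
\<close>

lemma I_op_S_op:
  fixes \<psi> :: "'a \<Rightarrow> 'a"
  assumes "\<psi> \<in> C_Zp" "s \<in> Zp"
  shows "I_op (S_op \<psi>) s = I_op \<psi> (s + 1)"
proof -
  obtain B where B: "\<And>x. x \<in> Zp \<Longrightarrow> av (\<psi> x) \<le> B"
    using C_Zp_bounded[OF assms(1)] by blast
  define a where "a n = fact n * S_op \<psi> (- 1 - of_nat n) * (s gchoose n)" for n
  define b where "b n = fact n * \<psi> (- 1 - of_nat n) * ((s + 1) gchoose n)" for n
  have S: "S_op \<psi> (- 1 - of_nat n) = \<psi> (- 1 - of_nat n) + of_nat (Suc n) * \<psi> (- 1 - of_nat (Suc n))"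
    for n
    by (simp add: S_op_def algebra_simps)
  have telescope: "sum a {..<Suc n} - sum b {..<Suc n}
      = fact (Suc n) * (s gchoose n) * \<psi> (- 1 - of_nat (Suc n))" for n
  proof (induction n)
    case 0
    show ?case using S[of 0] by (simp add: a_def b_def)
  next
    case (Suc n)
    have "a (Suc n) - b (Suc n) = fact (Suc (Suc n)) * (s gchoose Suc n) * \<psi> (- 1 - of_nat (Suc (Suc n)))
       - fact (Suc n) * (s gchoose n) * \<psi> (- 1 - of_nat (Suc n))"
      unfolding a_def b_def S gbinomial_Suc_Suc fact_Suc[of "Suc n"] of_nat_mult
      by (simp only: algebra_simps)
    then show ?case
      using Suc by (simp add: algebra_simps)
  qed
  have "(\<lambda>n. sum a {..<Suc n} - sum b {..<Suc n}) \<longlonglongrightarrow> 0"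
  proof -
    have "av (sum a {..<Suc n} - sum b {..<Suc n}) \<le> av (fact (Suc n)) * B" for n
    proof -
      have "av (fact (Suc n)) * av (s gchoose n) * av (\<psi> (- 1 - of_nat (Suc n)))
          \<le> av (fact (Suc n)) * 1 * B"
        using av_gbinomial_le_1[OF assms(2), of n] B[of "- 1 - of_nat (Suc n)"]
        by (intro mult_mono) (auto simp del: of_nat_Suc fact_Suc)
      then show ?thesis
        by (simp only: telescope av_mult mult_1_right)
    qed
    moreover have "(\<lambda>n. av (fact (Suc n)) * B) \<longlonglongrightarrow> 0 * B"
      by (intro tendsto_intros LIMSEQ_Suc[OF av_fact_tendsto_0])
    ultimately show ?thesis
      by (intro tendsto_av_comparison[of "\<lambda>n. av (fact (Suc n)) * B"]) simp_all
  qed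
  then have diff: "(\<lambda>n. sum a {..<n} - sum b {..<n}) \<longlonglongrightarrow> 0"
    by (rule LIMSEQ_imp_Suc)
  have "a sums l \<longleftrightarrow> b sums l" for l
  proof
    assume "a sums l"
    then show "b sums l"
      using tendsto_av_diff[OF _ diff, of "\<lambda>n. sum a {..<n}" l] by (simp add: sums_def)
  next
    assume "b sums l"
    then show "a sums l"
      using tendsto_av_add[OF _ diff, of "\<lambda>n. sum b {..<n}" l] by (simp add: sums_def)
  qed
  then show ?thesis
    by (simp add: I_op_def suminf_def a_def[abs_def] b_def[abs_def])
qed

lemma funpow_S_op_C_Zp:
  fixes \<psi> :: "'a \<Rightarrow> 'a"
  assumes "\<psi> \<in> C_Zp"
  shows "(S_op ^^ n) \<psi> \<in> C_Zp"
  by (induction n) (auto simp: assms S_op_C_Zp)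

lemma I_op_funpow_S_op:
  fixes \<psi> :: "'a \<Rightarrow> 'a"
  assumes "\<psi> \<in> C_Zp" "s \<in> Zp"
  shows "I_op ((S_op ^^ n) \<psi>) s = I_op \<psi> (s + of_nat n)"
  using assms(2)
proof (induction n arbitrary: s)
  case (Suc n)
  have "s + 1 \<in> Zp"
    using Zp_add_of_int[OF Suc.prems, of 1] by simp
  then show ?case
    using Suc I_op_S_op[OF funpow_S_op_C_Zp[OF assms(1)] Suc.prems] by (simp add: algebra_simps)
qed simp

lemma funpow_S_op_inverse:
  fixes \<psi> :: "'a \<Rightarrow> 'a"
  assumes "\<psi> \<in> C_Zp"
  shows "(inv_into C_Zp S_op ^^ n) \<psi> \<in> C_Zp \<and> (S_op ^^ n) ((inv_into C_Zp S_op ^^ n) \<psi>) = \<psi>"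
proof (induction n)
  case (Suc n)
  let ?\<theta> = "(inv_into C_Zp S_op ^^ n) \<psi>"
  have "?\<theta> \<in> S_op ` C_Zp"
    using Suc bij_betw_S_op by (simp add: bij_betw_def)
  then have "inv_into C_Zp S_op ?\<theta> \<in> C_Zp" "S_op (inv_into C_Zp S_op ?\<theta>) = ?\<theta>"
    by (simp_all add: inv_into_into f_inv_into_f)
  then show ?case
    using Suc by (simp only: funpow.simps(2)[of n "inv_into C_Zp S_op"] funpow_Suc_right[of n S_op] o_apply)
qed (simp add: assms)

end

theorem corollary6p6:
  fixes p :: nat
    and av :: "'a::{field_char_0,complete_space} \<Rightarrow> real"
    and \<psi> :: "'a \<Rightarrow> 'a" and m :: int and s :: 'a
  assumes "prime p"
    and "padic_complex_field p av"
    and "\<psi> \<in> C_Zp"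
    and "s \<in> Zp"
  shows "I_op (S_pow m \<psi>) s = I_op \<psi> (s + of_int m)"
proof -
  interpret padic_complex_field p av
    by (fact assms(2))
  show ?thesis
  proof (cases "m \<ge> 0")
    case True
    then show ?thesis
      using I_op_funpow_S_op[OF assms(3,4), of "nat m"] by (simp add: S_pow_def)
  next
    case False
    define n where "n = nat (- m)"
    have m: "m = - int n"
      using False by (simp add: n_def)
    \<comment> \<open>Apply the shift by \<open>n\<close> to \<open>?\<theta>\<close>, whose \<open>n\<close>-th iterate is \<open>\<psi>\<close>.\<close>
    let ?\<theta> = "(inv_into C_Zp S_op ^^ n) \<psi>"
    have \<theta>: "?\<theta> \<in> C_Zp" "(S_op ^^ n) ?\<theta> = \<psi>"
      using funpow_S_op_inverse[OF assms(3)] by auto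
    have "I_op \<psi> (s + of_int m) = I_op ((S_op ^^ n) ?\<theta>) (s + of_int m)"
      by (simp add: \<theta>)
    also have "\<dots> = I_op ?\<theta> (s + of_int m + of_nat n)"
      by (rule I_op_funpow_S_op[OF \<theta>(1) Zp_add_of_int[OF assms(4)]])
    also have "\<dots> = I_op (S_pow m \<psi>) s"
      using False by (simp add: m S_pow_def)
    finally show ?thesis ..
  qed
qed

end
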